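(* Let $A\in \mathbb{R}^{m\times n}$ be such that $A^{\dagger}\geq 0$. Let $A=P_{1}-R_{1}+S_{1}$ be a regular proper double splitting of $A$ such that $P_{1}P_{1}^{\dagger}\geq 0$, and let $A=P_{2}-R_{2}+S_{2}$ be a weak regular proper double splitting of $A$. Define $$W_{1}=\begin{pmatrix} P_{1}^{\dagger}R_{1} & -P_{1}^{\dagger}S_{1}\\ I & 0\end{pmatrix},\qquad W_{2}=\begin{pmatrix} P_{2}^{\dagger}R_{2} & -P_{2}^{\dagger}S_{2}\\ I & 0\end{pmatrix}\in\mathbb{R}^{2n\times 2n},$$ where $I$ is the $n\times n$ identity matrix. If $P_{1}^{\dagger}\geq P_{2}^{\dagger}$ and at least one of the conditions (i) $P_{1}^{\dagger}R_{1}\geq P_{2}^{\dagger}R_{2}$, (ii) $P_{1}^{\dagger}S_{1}\geq P_{2}^{\dagger}S_{2}$ holds, then $\rho(W_{1})\leq \rho(W_{2})< 1$.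
   Context: $A^{\dagger}$ denotes the Moore–Penrose inverse of $A$. For real matrices, $B\geq 0$ means all entries of $B$ are nonnegative, and $B\geq C$ means $B-C\geq 0$. $\rho(\cdot)$ denotes the spectral radius. For $A\in\mathbb{R}^{m\times n}$, a decomposition $A=P-R+S$ with $P,R,S\in\mathbb{R}^{m\times n}$ is a proper double splitting if $\mathcal{R}(A)=\mathcal{R}(P)$ and $\mathcal{N}(A)=\mathcal{N}(P)$ (range and null space). A proper double splitting is called regular if $P^{\dagger}\geq 0$, $R\geq 0$ and $-S\geq 0$; it is called weak regular if $P^{\dagger}\geq 0$, $P^{\dagger}R\geq 0$ and $-P^{\dagger}S\geq 0$. *)

theory Defs
  imports "HOL-Analysis.Analysis"
begin

definition nonneg_mat :: "real^'n^'m \<Rightarrow> bool" where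
  "nonneg_mat B \<longleftrightarrow> (\<forall>i j. B $ i $ j \<ge> 0)"

definition mp_inv :: "real^'n^'m \<Rightarrow> real^'m^'n" where
  "mp_inv A = (THE X. A ** X ** A = A \<and> X ** A ** X = X \<and>
                      transpose (A ** X) = A ** X \<and> transpose (X ** A) = X ** A)"

definition mat_range :: "real^'n^'m \<Rightarrow> (real^'m) set" where
  "mat_range A = {A *v x | x. True}"

definition mat_null :: "real^'n^'m \<Rightarrow> (real^'n) set" where
  "mat_null A = {x. A *v x = 0}"

definition proper_double_splitting ::
  "real^'n^'m \<Rightarrow> real^'n^'m \<Rightarrow> real^'n^'m \<Rightarrow> real^'n^'m \<Rightarrow> bool" where
  "proper_double_splitting A P R S \<longleftrightarrow>
     A = P - R + S \<and> mat_range A = mat_range P \<and> mat_null A = mat_null P"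

definition regular_pds ::
  "real^'n^'m \<Rightarrow> real^'n^'m \<Rightarrow> real^'n^'m \<Rightarrow> real^'n^'m \<Rightarrow> bool" where
  "regular_pds A P R S \<longleftrightarrow> proper_double_splitting A P R S \<and>
     nonneg_mat (mp_inv P) \<and> nonneg_mat R \<and> nonneg_mat (- S)"

definition weak_regular_pds ::
  "real^'n^'m \<Rightarrow> real^'n^'m \<Rightarrow> real^'n^'m \<Rightarrow> real^'n^'m \<Rightarrow> bool" where
  "weak_regular_pds A P R S \<longleftrightarrow> proper_double_splitting A P R S \<and>
     nonneg_mat (mp_inv P) \<and> nonneg_mat (mp_inv P ** R) \<and> nonneg_mat (- (mp_inv P ** S))"

definition iter_mat :: "real^'n^'n \<Rightarrow> real^'n^'n \<Rightarrow> real^('n + 'n)^('n + 'n)" where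
  "iter_mat B C = (\<chi> i j. case i of
       Inl a \<Rightarrow> (case j of Inl b \<Rightarrow> B $ a $ b | Inr b \<Rightarrow> C $ a $ b)
     | Inr a \<Rightarrow> (case j of Inl b \<Rightarrow> (if a = b then 1 else 0) | Inr b \<Rightarrow> 0))"

definition mat_spectrum :: "real^'k^'k \<Rightarrow> complex set" where
  "mat_spectrum A = {z. \<exists>v :: complex^'k. v \<noteq> 0 \<and>
       (\<chi> i j. complex_of_real (A $ i $ j)) *v v = z *s v}"

definition spec_rad :: "real^'k^'k \<Rightarrow> real" where
  "spec_rad A = Max (cmod ` mat_spectrum A)"

end

theory Submission
  imports Defs
begin

text \<open>Write \<open>T\<^sub>i = P\<^sub>i\<^sup>\<dagger> (R\<^sub>i - S\<^sub>i)\<close>. Since \<open>P\<^sub>i\<close> and \<open>A\<close> have the same range and null space,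
  \<open>T\<^sub>i = A\<^sup>\<dagger> A - P\<^sub>i\<^sup>\<dagger> A\<close>, hence \<open>A\<^sup>\<dagger> = P\<^sub>i\<^sup>\<dagger> + T\<^sub>i A\<^sup>\<dagger>\<close>. If \<open>0 \<le> u \<le> T\<^sub>i u\<close>, iterating the last identity on
  \<open>w = \<bar>(R\<^sub>i - S\<^sub>i) u\<bar>\<close> gives \<open>N u \<le> A\<^sup>\<dagger> w\<close> for all \<open>N\<close>, so \<open>u = 0\<close>; a Perron vector of \<open>W\<^sub>i\<close> for an
  eigenvalue at least 1 would yield such a \<open>u\<close>. For the comparison, let \<open>(\<rho> x, x)\<close> be a Perron
  vector of \<open>W\<^sub>1\<close> with \<open>0 < \<rho> < 1\<close>. Regularity gives \<open>A x \<ge> 0\<close>, so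
  \<open>(T\<^sub>2 - T\<^sub>1) x = (P\<^sub>1\<^sup>\<dagger> - P\<^sub>2\<^sup>\<dagger>) A x \<ge> 0\<close>, and either of the two alternatives turns this into
  \<open>W\<^sub>2 (\<rho> x, x) \<ge> \<rho> (\<rho> x, x)\<close>, which bounds \<open>\<rho>\<close> by the spectral radius of \<open>W\<^sub>2\<close>.\<close>

section \<open>The Moore--Penrose inverse\<close>

definition is_mp_inv :: "real^'n^'m \<Rightarrow> real^'m^'n \<Rightarrow> bool" where
  "is_mp_inv A X \<longleftrightarrow> A ** X ** A = A \<and> X ** A ** X = X \<and>
     transpose (A ** X) = A ** X \<and> transpose (X ** A) = X ** A"

text \<open>Split \<open>y\<close> orthogonally along the range of \<open>A\<close>: the residual
  \<open>q\<close> is orthogonal to every \<open>A *v z\<close>, so \<open>transpose A\<close> kills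
  it.\<close>

lemma normal_equations_solvable:
  fixes A :: "real^'n^'m"
  shows "\<exists>x. transpose A *v (A *v x) = transpose A *v y"
proof -
  let ?S = "range (\<lambda>x. A *v x)"
  have sub: "subspace ?S"
    by (intro linear_subspace_image) auto
  obtain p q where p: "p \<in> span ?S" and q: "\<And>w. w \<in> span ?S \<Longrightarrow> orthogonal q w"
    and y: "y = p + q"
    using orthogonal_subspace_decomp_exists[of ?S y] by metis
  have "p \<in> ?S"
    using p sub by (metis span_eq_iff)
  then obtain x where x: "p = A *v x"
    by blast
  have "(transpose A *v q) \<bullet> z = 0" for z
    using q[of "A *v z"] by (simp add: span_base orthogonal_def dot_lmul_matrix)
  then have "transpose A *v q = 0"
    by (metis inner_eq_zero_iff)
  then show ?thesis
    using x y by (metis add.right_neutral matrix_vector_right_distrib)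
qed

lemma normal_equations_solvable_matrix:
  fixes A :: "real^'n^'m"
  shows "\<exists>Y. transpose A ** A ** Y = transpose A"
proof -
  have "\<forall>j. \<exists>x. transpose A *v (A *v x) = transpose A *v axis j 1"
    using normal_equations_solvable by blast
  then obtain f where f: "\<And>j. transpose A *v (A *v f j) = transpose A *v axis j 1"
    by metis
  define Y where "Y = (\<chi> i j. f j $ i)"
  have Y: "Y *v axis j 1 = f j" for j
    by (simp add: Y_def matrix_vector_mult_basis column_def vec_eq_iff)
  have "column j (transpose A ** A ** Y) = column j (transpose A)" for j
    using f[of j] Y[of j]
    by (simp add: matrix_vector_mult_basis[symmetric] matrix_vector_mul_assoc[symmetric])
  then have "transpose A ** A ** Y = transpose A"
    by (simp add: column_def vec_eq_iff)
  then show ?thesis ..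
qed

text \<open>The transposed normal equations read \<open>transpose (A ** Y) ** A = A\<close>.
  Multiplying by \<open>Y\<close> on the right exhibits \<open>A ** Y\<close> as a Gram matrix,
  hence symmetric.\<close>

lemma ex_least_squares_inverse:
  fixes A :: "real^'n^'m"
  shows "\<exists>Y. A ** Y ** A = A \<and> transpose (A ** Y) = A ** Y"
proof -
  obtain Y where Y: "transpose A ** A ** Y = transpose A"
    using normal_equations_solvable_matrix by blast
  have "transpose (transpose A ** A ** Y) = A"
    using Y by simp
  then have Y': "transpose Y ** transpose A ** A = A"
    by (simp add: matrix_transpose_mul matrix_mul_assoc)
  have "transpose (A ** Y) ** (A ** Y) = A ** Y"
    using Y' by (simp add: matrix_transpose_mul matrix_mul_assoc)
  then have sym: "transpose (A ** Y) = A ** Y"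
    by (metis matrix_transpose_mul transpose_transpose)
  then have "A ** Y ** A = A"
    using Y' by (metis matrix_transpose_mul)
  with sym show ?thesis by blast
qed

text \<open>\<open>Y\<close> makes \<open>A ** Y\<close> symmetric, and \<open>Z\<close>, obtained
  from \<open>transpose A\<close>, makes \<open>Z ** A\<close> symmetric. The product
  \<open>Z ** A ** Y\<close> inherits both: \<open>A\<close> on its left leaves
  \<open>A ** Y\<close>, \<open>A\<close> on its right leaves \<open>Z ** A\<close>.\<close>

lemma ex_is_mp_inv:
  fixes A :: "real^'n^'m"
  shows "\<exists>X. is_mp_inv A X"
proof -
  obtain Y where Y: "A ** Y ** A = A" "transpose (A ** Y) = A ** Y"
    using ex_least_squares_inverse by blast
  obtain Z' where Z': "transpose A ** Z' ** transpose A = transpose A"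
      "transpose (transpose A ** Z') = transpose A ** Z'"
    using ex_least_squares_inverse by blast
  define Z where "Z = transpose Z'"
  have Z2: "transpose (Z ** A) = Z ** A"
    using Z'(2) by (simp add: Z_def matrix_transpose_mul)
  have Z1: "A ** Z ** A = A"
    using arg_cong[OF Z'(1), of transpose]
    by (simp add: Z_def matrix_transpose_mul matrix_mul_assoc)
  have 1: "A ** (Z ** A ** Y) = A ** Y"
    using Z1 by (simp add: matrix_mul_assoc)
  have 2: "Z ** A ** Y ** A = Z ** A"
    using Y(1) by (metis matrix_mul_assoc)
  have "Z ** A ** Y ** A ** (Z ** A ** Y) = Z ** A ** Y"
    using 2 Z1 by (metis matrix_mul_assoc)
  then have "is_mp_inv A (Z ** A ** Y)"
    using 1 2 Y Z2 by (simp add: is_mp_inv_def)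
  then show ?thesis ..
qed

text \<open>Transposing a product of symmetric matrices swaps its factors; this forces
  \<open>A ** X = A ** Y\<close> and \<open>X ** A = Y ** A\<close>, whence X = XAX = XAY = YAY =
  Y.\<close>

lemma is_mp_inv_unique:
  assumes "is_mp_inv A X" "is_mp_inv A Y"
  shows "X = Y"
proof -
  note X = assms(1)[unfolded is_mp_inv_def] and Y = assms(2)[unfolded is_mp_inv_def]
  have "A ** X = (A ** Y) ** (A ** X)"
    using Y by (simp add: matrix_mul_assoc)
  then have "transpose (A ** X) = transpose (A ** X) ** transpose (A ** Y)"
    by (metis matrix_transpose_mul)
  then have AX: "A ** X = A ** Y"
    using X Y by (simp add: matrix_mul_assoc)
  have "X ** A = (X ** A) ** (Y ** A)"
    using Y by (metis matrix_mul_assoc)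
  then have "transpose (X ** A) = transpose (Y ** A) ** transpose (X ** A)"
    by (metis matrix_transpose_mul)
  then have XA: "X ** A = Y ** A"
    using X Y by (metis matrix_mul_assoc)
  show ?thesis
    using X Y AX XA by (metis matrix_mul_assoc)
qed

lemma is_mp_inv_mp_inv: "is_mp_inv A (mp_inv A)"
proof -
  have "\<exists>!X. is_mp_inv A X"
    using ex_is_mp_inv is_mp_inv_unique by blast
  then have "is_mp_inv A (THE X. is_mp_inv A X)"
    by (rule theI')
  then show ?thesis
    by (simp add: mp_inv_def is_mp_inv_def)
qed

lemma mp_inv_mult_self [simp]: "A ** mp_inv A ** A = A"
  and mp_inv_self_mult [simp]: "mp_inv A ** A ** mp_inv A = mp_inv A"
  and transpose_mult_mp_inv [simp]: "transpose (A ** mp_inv A) = A ** mp_inv A"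
  and transpose_mp_inv_mult [simp]: "transpose (mp_inv A ** A) = mp_inv A ** A"
  using is_mp_inv_mp_inv[of A] by (auto simp: is_mp_inv_def)

section \<open>Projections for matrices with equal range or null space\<close>

lemma range_projection_absorbs:
  assumes "mat_range A \<subseteq> mat_range P"
  shows "P ** mp_inv P ** A = A"
proof -
  have "(P ** mp_inv P ** A) *v x = A *v x" for x
  proof -
    have "A *v x \<in> mat_range P"
      using assms by (auto simp: mat_range_def)
    then obtain y where y: "A *v x = P *v y"
      by (auto simp: mat_range_def)
    have "(P ** mp_inv P ** A) *v x = (P ** mp_inv P) *v (A *v x)"
      by (simp add: matrix_vector_mul_assoc)
    also have "\<dots> = P *v y"
      by (simp add: y matrix_vector_mul_assoc)
    finally show ?thesis
      by (simp add: y)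
  qed
  then show ?thesis
    by (simp add: matrix_eq)
qed

lemma null_projection_absorbs:
  assumes "mat_null P \<subseteq> mat_null A"
  shows "A ** (mp_inv P ** P) = A"
proof -
  have "(A ** (mp_inv P ** P)) *v x = A *v x" for x
  proof -
    have "P *v (x - (mp_inv P ** P) *v x) = 0"
      by (simp add: matrix_vector_mult_diff_distrib matrix_vector_mul_assoc matrix_mul_assoc)
    then have "A *v (x - (mp_inv P ** P) *v x) = 0"
      using assms by (auto simp: mat_null_def)
    then show ?thesis
      by (simp add: matrix_vector_mult_diff_distrib matrix_vector_mul_assoc)
  qed
  then show ?thesis
    by (simp add: matrix_eq)
qed

text \<open>Symmetric matrices that absorb each other coincide: transposing one absorption identity
  swaps its factors.\<close>

lemma mult_mp_inv_eq_if_range_eq: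
  assumes "mat_range A = mat_range P"
  shows "A ** mp_inv A = P ** mp_inv P"
proof -
  have "P ** mp_inv P ** (A ** mp_inv A) = A ** mp_inv A"
    using range_projection_absorbs[of A P] assms by (simp add: matrix_mul_assoc)
  moreover have "A ** mp_inv A ** (P ** mp_inv P) = P ** mp_inv P"
    using range_projection_absorbs[of P A] assms by (simp add: matrix_mul_assoc)
  ultimately show ?thesis
    by (metis matrix_transpose_mul transpose_mult_mp_inv)
qed

lemma mp_inv_mult_eq_if_null_eq:
  assumes "mat_null A = mat_null P"
  shows "mp_inv A ** A = mp_inv P ** P"
proof -
  have "mp_inv A ** A ** (mp_inv P ** P) = mp_inv A ** A"
    using null_projection_absorbs[of P A] assms by (simp add: matrix_mul_assoc[symmetric])
  moreover have "mp_inv P ** P ** (mp_inv A ** A) = mp_inv P ** P"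
    using null_projection_absorbs[of A P] assms by (simp add: matrix_mul_assoc[symmetric])
  ultimately show ?thesis
    by (metis matrix_transpose_mul transpose_mp_inv_mult)
qed

section \<open>Nonnegative matrices and the spectral radius\<close>

lemma nonneg_mat_mult_vec:
  assumes "nonneg_mat M" "0 \<le> x"
  shows "0 \<le> M *v x"
  using assms
  by (auto simp: nonneg_mat_def less_eq_vec_def matrix_vector_mult_def intro!: sum_nonneg)

lemma nonneg_mat_mult_vec_mono:
  assumes "nonneg_mat M" "x \<le> y"
  shows "M *v x \<le> M *v y"
  using nonneg_mat_mult_vec[OF assms(1), of "y - x"] assms(2)
  by (simp add: matrix_vector_mult_diff_distrib)

lemma nonneg_mat_mult:
  assumes "nonneg_mat M" "nonneg_mat N"
  shows "nonneg_mat (M ** N)"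
  using assms by (auto simp: nonneg_mat_def matrix_matrix_mult_def intro!: sum_nonneg)

text \<open>The set of vectors \<open>x\<close> in the standard simplex with \<open>\<rho> x \<le> W x\<close> is compact, convex, and
  mapped to itself by \<open>x \<mapsto> W x / \<parallel>W x\<parallel>\<^sub>1\<close>; a Brouwer fixed point is an eigenvector.\<close>

lemma nonneg_eigenvector_ge:
  fixes W :: "real^'k^'k"
  assumes W: "nonneg_mat W" and x: "0 \<le> x" "x \<noteq> 0" "\<rho> *\<^sub>R x \<le> W *v x"
  obtains r y where "\<rho> \<le> r" "0 \<le> y" "y \<noteq> 0" "W *v y = r *\<^sub>R y"
proof -
  \<comment> \<open>On nonnegative vectors \<open>s\<close> is the 1-norm; its linearity makes
    \<open>S\<close> convex.\<close>
  define s :: "real^'k \<Rightarrow> real" where "s x = (\<Sum>i\<in>UNIV. x $ i)" for x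
  define S where "S = {x. 0 \<le> x \<and> s x = 1 \<and> \<rho> *\<^sub>R x \<le> W *v x}"
  have s_scale: "s (c *\<^sub>R x) = c * s x" for c x
    by (simp add: s_def sum_distrib_left)
  have s_add: "s (x + y) = s x + s y" for x y
    by (simp add: s_def sum.distrib)
  have s_nonneg: "0 \<le> s x" if "0 \<le> x" for x
    using that by (auto simp: s_def less_eq_vec_def intro: sum_nonneg)
  have s_mono: "s x \<le> s y" if "x \<le> y" for x y
    using that by (auto simp: s_def less_eq_vec_def intro: sum_mono)
  have s_pos: "0 < s x" if "0 \<le> x" "x \<noteq> 0" for x
  proof -
    have "s x \<noteq> 0"
      using that by (auto simp: s_def less_eq_vec_def sum_nonneg_eq_0_iff vec_eq_iff)
    then show ?thesis
      using s_nonneg[OF that(1)] by simp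
  qed
  have s_cont: "continuous_on T s" for T
    unfolding s_def by (intro continuous_intros)
  have W_cont: "continuous_on T (\<lambda>x. W *v x)" for T
    by (intro linear_continuous_on linear_conv_bounded_linear[THEN iffD1]) auto
  have S_norm: "(1 / s x) *\<^sub>R x \<in> S" if "0 \<le> x" "x \<noteq> 0" "\<rho> *\<^sub>R x \<le> W *v x" for x
  proof -
    have "(1 / s x) *\<^sub>R (\<rho> *\<^sub>R x) \<le> (1 / s x) *\<^sub>R (W *v x)"
      using that s_pos[OF that(1,2)] by (intro scaleR_left_mono) auto
    then show ?thesis
      using that s_pos[OF that(1,2)]
      by (auto simp: S_def s_scale matrix_vector_mult_scaleR scaleR_nonneg_nonneg mult.commute)
  qed
  have "convex S"
  proof (rule convexI)
    fix x y and u v :: real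
    assume xy: "x \<in> S" "y \<in> S" and uv: "0 \<le> u" "0 \<le> v" "u + v = 1"
    have "u *\<^sub>R (\<rho> *\<^sub>R x) + v *\<^sub>R (\<rho> *\<^sub>R y) \<le> u *\<^sub>R (W *v x) + v *\<^sub>R (W *v y)"
      using xy uv by (intro add_mono scaleR_left_mono) (auto simp: S_def)
    then show "u *\<^sub>R x + v *\<^sub>R y \<in> S"
      using xy uv
      by (auto simp: S_def s_add s_scale scaleR_nonneg_nonneg matrix_vector_right_distrib
          matrix_vector_mult_scaleR algebra_simps)
  qed
  moreover have "compact S"
  proof -
    have "norm x \<le> 1" if "x \<in> S" for x
    proof -
      have "norm x \<le> (\<Sum>i\<in>UNIV. \<bar>x $ i\<bar>)"
        by (rule norm_le_l1_cart)
      also have "\<dots> = s x"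
        using that by (auto simp: S_def s_def less_eq_vec_def intro: sum.cong)
      finally show ?thesis
        using that by (simp add: S_def)
    qed
    then have "bounded S"
      by (auto simp: bounded_iff)
    moreover have "closed S"
    proof -
      have "S = {x. \<forall>i. 0 \<le> x $ i} \<inter> {x. s x = 1} \<inter> {x. \<forall>i. \<rho> * x $ i \<le> (W *v x) $ i}"
        by (auto simp: S_def less_eq_vec_def)
      moreover have "closed {x :: real^'k. \<forall>i. 0 \<le> x $ i}"
        by (intro closed_Collect_all closed_Collect_le continuous_intros)
      moreover have "closed {x. s x = 1}"
        by (intro closed_Collect_eq s_cont continuous_intros)
      moreover have "closed {x. \<forall>i. \<rho> * x $ i \<le> (W *v x) $ i}"
        by (intro closed_Collect_all closed_Collect_le continuous_intros W_cont)
      ultimately show ?thesis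
        by auto
    qed
    ultimately show ?thesis
      by (simp add: compact_eq_bounded_closed)
  qed
  moreover have "S \<noteq> {}"
    using S_norm[OF x] by auto
  ultimately have S: "compact S" "convex S" "S \<noteq> {}"
    by auto
  show thesis
  \<comment> \<open>The normalized map is undefined where \<open>W *v y = 0\<close>. Such a
    \<open>y\<close> is an eigenvector for 0, and it forces \<rho> \<le> 0.\<close>
  proof (cases "\<exists>y\<in>S. W *v y = 0")
    case True
    then obtain y where y: "y \<in> S" "W *v y = 0"
      by blast
    have "y \<noteq> 0"
      using y by (auto simp: S_def s_def)
    have "s (\<rho> *\<^sub>R y) \<le> s (W *v y)"
      using y by (intro s_mono) (auto simp: S_def)
    then have "\<rho> \<le> 0"
      using y by (simp add: S_def s_scale) (simp add: s_def)
    then show thesis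
      using that[of 0 y] y \<open>y \<noteq> 0\<close> by (auto simp: S_def)
  next
    case False
    have nz: "0 \<le> W *v y" "W *v y \<noteq> 0" if "y \<in> S" for y
      using False that nonneg_mat_mult_vec[OF W] by (auto simp: S_def)
    let ?f = "\<lambda>y. (1 / s (W *v y)) *\<^sub>R (W *v y)"
    have "?f y \<in> S" if "y \<in> S" for y
    proof (rule S_norm[OF nz[OF that]])
      have "W *v (\<rho> *\<^sub>R y) \<le> W *v (W *v y)"
        using that by (intro nonneg_mat_mult_vec_mono[OF W]) (auto simp: S_def)
      then show "\<rho> *\<^sub>R (W *v y) \<le> W *v (W *v y)"
        by (simp add: matrix_vector_mult_scaleR)
    qed
    moreover have "continuous_on S ?f"
    proof (intro continuous_intros W_cont)
      show "continuous_on S (\<lambda>y. s (W *v y))"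
        by (rule continuous_on_compose2[OF s_cont[of UNIV] W_cont]) auto
      show "\<forall>y\<in>S. s (W *v y) \<noteq> 0"
        using s_pos nz by (metis less_irrefl)
    qed
    ultimately obtain y where y: "y \<in> S" "?f y = y"
      using brouwer[OF S, of ?f] by blast
    let ?r = "s (W *v y)"
    have "W *v y = ?r *\<^sub>R ?f y"
      using s_pos[OF nz[OF y(1)]] by simp
    then have eig: "W *v y = ?r *\<^sub>R y"
      using y(2) by simp
    have "y \<noteq> 0"
      using y by (auto simp: S_def s_def)
    have "s (\<rho> *\<^sub>R y) \<le> s (W *v y)"
      using y by (intro s_mono) (auto simp: S_def)
    then have "\<rho> \<le> ?r"
      using y by (simp add: S_def s_scale)
    then show thesis
      using that[of ?r y] y(1) eig \<open>y \<noteq> 0\<close> by (auto simp: S_def)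
  qed
qed

section \<open>Spectrum and Perron vectors\<close>

text \<open>Makes the \<open>Max\<close> in \<open>spec_rad\<close> meaningful. Eigenvalues are the
  roots of \<open>p\<close>, the characteristic polynomial up to sign.\<close>

lemma finite_mat_spectrum: "finite (mat_spectrum A)"
proof -
  let ?C = "(\<chi> i j. complex_of_real (A $ i $ j)) :: complex^'a^'a"
  define M :: "complex \<Rightarrow> complex^'a^'a" where "M z = ?C - mat z" for z
  define p where "p = det ((\<chi> i j. [:complex_of_real (A $ i $ j):] -
    (if i = j then [:0, 1:] else 0)) :: complex poly^'a^'a)"
  have M_mult: "M z *v v = ?C *v v - z *s v" for z v
    by (simp add: M_def matrix_vector_mult_diff_rdistrib)
      (simp add: vec_eq_iff matrix_vector_mult_def mat_def if_distrib if_distribR sum.delta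
        cong: if_cong)
  have det: "det (M z) = poly p z" for z
    unfolding p_def det_def M_def
    by (auto simp: poly_sum poly_prod mat_def intro!: sum.cong prod.cong)
  have spec: "z \<in> mat_spectrum A \<longleftrightarrow> poly p z = 0" for z
  proof -
    have "z \<in> mat_spectrum A \<longleftrightarrow> (\<exists>v. v \<noteq> 0 \<and> M z *v v = 0)"
      by (simp add: mat_spectrum_def M_mult)
    also have "\<dots> \<longleftrightarrow> \<not> invertible (M z)"
      by (metis invertible_left_inverse matrix_left_invertible_ker)
    finally show ?thesis
      by (simp add: invertible_det_nz det)
  qed
  \<comment> \<open>To see that \<open>p\<close> is nonzero, bound all eigenvalues by
    \<open>K\<close>, summing the moduli of the eigenvector equation; \<open>K + 1\<close> is then
    no root.\<close>
  define K where "K = (\<Sum>i\<in>UNIV. \<Sum>j\<in>UNIV. \<bar>A $ i $ j\<bar>)"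
  have "K \<ge> 0"
    by (auto simp: K_def intro!: sum_nonneg)
  have bound: "cmod z \<le> K" if "z \<in> mat_spectrum A" for z
  proof -
    obtain v where v: "v \<noteq> 0" "?C *v v = z *s v"
      using \<open>z \<in> _\<close> by (auto simp: mat_spectrum_def)
    let ?n = "\<Sum>j\<in>UNIV. cmod (v $ j)"
    have "cmod z * ?n = (\<Sum>i\<in>UNIV. cmod ((z *s v) $ i))"
      by (simp add: norm_mult sum_distrib_left)
    also have "\<dots> \<le> (\<Sum>i\<in>UNIV. \<Sum>j\<in>UNIV. \<bar>A $ i $ j\<bar> * cmod (v $ j))"
      unfolding v(2)[symmetric]
      by (intro sum_mono) (auto simp: matrix_vector_mult_def norm_mult intro!: sum_norm_le)
    also have "\<dots> \<le> (\<Sum>i\<in>UNIV. \<Sum>j\<in>UNIV. \<bar>A $ i $ j\<bar> * ?n)"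
      by (intro sum_mono mult_left_mono member_le_sum) auto
    also have "\<dots> = K * ?n"
      by (simp add: K_def sum_distrib_right)
    finally have "cmod z * ?n \<le> K * ?n" .
    moreover have "?n > 0"
    proof -
      obtain j where "v $ j \<noteq> 0"
        using v(1) by (auto simp: vec_eq_iff)
      then show ?thesis
        by (intro sum_pos2[of _ j]) auto
    qed
    ultimately show ?thesis
      by simp
  qed
  have "cmod (complex_of_real (K + 1)) > K"
    using \<open>K \<ge> 0\<close> unfolding norm_of_real by simp
  then have "complex_of_real (K + 1) \<notin> mat_spectrum A"
    using bound by (metis not_le)
  then have "p \<noteq> 0"
    unfolding spec using poly_0 by metis
  then have "finite {z. poly p z = 0}"
    by (rule poly_roots_finite)
  moreover have "mat_spectrum A = {z. poly p z = 0}"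
    using spec by blast
  ultimately show ?thesis
    by simp
qed

lemma real_eigenvalue_in_mat_spectrum:
  assumes "W *v y = r *\<^sub>R y" "y \<noteq> 0"
  shows "complex_of_real r \<in> mat_spectrum W"
proof -
  let ?v = "(\<chi> i. complex_of_real (y $ i))"
  have "(\<Sum>j\<in>UNIV. W $ i $ j * y $ j) = r * y $ i" for i
    using assms(1) by (simp add: vec_eq_iff matrix_vector_mult_def)
  then have "(\<chi> i j. complex_of_real (W $ i $ j)) *v ?v = complex_of_real r *s ?v"
    by (simp add: vec_eq_iff matrix_vector_mult_def flip: of_real_mult of_real_sum)
  moreover have "?v \<noteq> 0"
    using assms(2) by (auto simp: vec_eq_iff)
  ultimately show ?thesis
    by (auto simp: mat_spectrum_def)
qed

text \<open>The lower Collatz-Wielandt bound: the Brouwer argument trades the subeigenvector for a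
  real eigenvalue at least \<rho>.\<close>

lemma le_spec_rad_if_subeigenvector:
  assumes "nonneg_mat W" "0 \<le> x" "x \<noteq> 0" "\<rho> *\<^sub>R x \<le> W *v x"
  shows "\<rho> \<le> spec_rad W"
proof -
  obtain r y where r: "\<rho> \<le> r" "y \<noteq> 0" "W *v y = r *\<^sub>R y"
    using nonneg_eigenvector_ge[OF assms] by metis
  have "cmod (complex_of_real r) \<le> spec_rad W"
    unfolding spec_rad_def using real_eigenvalue_in_mat_spectrum[OF r(3,2)]
    by (intro Max_ge finite_imageI finite_mat_spectrum imageI)
  then show ?thesis
    using r(1) by simp
qed

lemma nonneg_mat_spec_rad_nonneg:
  fixes W :: "real^'k^'k"
  assumes "nonneg_mat W"
  shows "0 \<le> spec_rad W"
proof (rule le_spec_rad_if_subeigenvector[OF assms])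
  show "0 \<le> (1 :: real^'k)" "(1 :: real^'k) \<noteq> 0"
    by (auto simp: less_eq_vec_def vec_eq_iff)
  then show "0 *\<^sub>R (1 :: real^'k) \<le> W *v 1"
    using nonneg_mat_mult_vec[OF assms] by simp
qed

text \<open>For an eigenvalue \<open>z\<close> of largest modulus, the triangle inequality makes the
  entrywise modulus \<open>u\<close> of its eigenvector a subeigenvector for \<open>cmod z\<close>.
  The resulting eigenvalue \<open>r\<close> is squeezed between \<open>cmod z\<close> and the
  spectral radius.\<close>

lemma perron_eigenvector:
  fixes W :: "real^'k^'k"
  assumes W: "nonneg_mat W"
  obtains x where "0 \<le> x" "x \<noteq> 0" "W *v x = spec_rad W *\<^sub>R x"
proof -
  \<comment> \<open>The all-ones vector, a subeigenvector for 0, shows that the spectrum is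
    nonempty, so the \<open>Max\<close> is attained.\<close>
  have one: "0 \<le> (1 :: real^'k)" "(1 :: real^'k) \<noteq> 0"
    by (auto simp: less_eq_vec_def vec_eq_iff)
  moreover have "0 *\<^sub>R (1 :: real^'k) \<le> W *v 1"
    using nonneg_mat_mult_vec[OF W one(1)] by simp
  ultimately obtain r0 y0 where "y0 \<noteq> 0" "W *v y0 = r0 *\<^sub>R y0"
    using nonneg_eigenvector_ge[OF W] by metis
  then have "mat_spectrum W \<noteq> {}"
    using real_eigenvalue_in_mat_spectrum by blast
  then have "spec_rad W \<in> cmod ` mat_spectrum W"
    unfolding spec_rad_def by (intro Max_in finite_imageI finite_mat_spectrum) auto
  then obtain z v where z: "spec_rad W = cmod z" and v: "v \<noteq> 0"
    "(\<chi> i j. complex_of_real (W $ i $ j)) *v v = z *s v"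
    by (auto simp: mat_spectrum_def)
  define u where "u = (\<chi> i. cmod (v $ i))"
  have "cmod z * cmod (v $ i) \<le> (\<Sum>j\<in>UNIV. W $ i $ j * cmod (v $ j))" for i
  proof -
    have "cmod z * cmod (v $ i) = cmod (\<Sum>j\<in>UNIV. complex_of_real (W $ i $ j) * v $ j)"
      using v(2) by (simp add: vec_eq_iff matrix_vector_mult_def norm_mult)
    also have "\<dots> \<le> (\<Sum>j\<in>UNIV. W $ i $ j * cmod (v $ j))"
      using W by (intro sum_norm_le) (simp add: norm_mult nonneg_mat_def)
    finally show ?thesis .
  qed
  then have "cmod z *\<^sub>R u \<le> W *v u"
    by (simp add: less_eq_vec_def u_def matrix_vector_mult_def)
  moreover have "0 \<le> u" "u \<noteq> 0"
    using v(1) by (auto simp: u_def less_eq_vec_def vec_eq_iff)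
  ultimately obtain r y where y: "cmod z \<le> r" "0 \<le> y" "y \<noteq> 0" "W *v y = r *\<^sub>R y"
    using nonneg_eigenvector_ge[OF W] by metis
  then have "r \<le> spec_rad W"
    by (intro le_spec_rad_if_subeigenvector[OF W y(2,3)]) auto
  then show thesis
    using that y z by force
qed

lemma matrix_mult_diff_distrib:
  fixes M :: "'a::ring_1^'n^'m"
  shows "M ** (X - Y) = M ** X - M ** Y"
  by (simp add: vec_eq_iff matrix_matrix_mult_def right_diff_distrib sum_subtractf)

lemma matrix_mult_diff_rdistrib:
  fixes X :: "'a::ring_1^'n^'m"
  shows "(X - Y) ** M = X ** M - Y ** M"
  by (simp add: vec_eq_iff matrix_matrix_mult_def left_diff_distrib sum_subtractf)

section \<open>The iteration matrix of a double splitting\<close>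

lemma nonneg_iter_mat:
  assumes "nonneg_mat B" "nonneg_mat C"
  shows "nonneg_mat (iter_mat B C)"
  using assms by (auto simp: nonneg_mat_def iter_mat_def split: sum.split)

lemma sum_UNIV_sum_type:
  "(\<Sum>k\<in>(UNIV :: ('a::finite + 'b::finite) set). f k) =
   (\<Sum>a\<in>UNIV. f (Inl a)) + (\<Sum>b\<in>UNIV. f (Inr b))"
  by (simp add: UNIV_Plus_UNIV[symmetric] sum.Plus del: UNIV_Plus_UNIV)

lemma iter_mat_mult_vec:
  fixes B C :: "real^'n^'n"
  shows "(iter_mat B C *v x) $ Inl a =
      (B *v (\<chi> a. x $ Inl a) + C *v (\<chi> a. x $ Inr a)) $ a" (is ?l)
    and "(iter_mat B C *v x) $ Inr a = x $ Inl a" (is ?r)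
proof -
  show ?l
    by (simp add: matrix_vector_mult_def sum_UNIV_sum_type iter_mat_def)
  show ?r
    by (simp add: matrix_vector_mult_def sum_UNIV_sum_type iter_mat_def if_distrib if_distribR
        sum.delta cong: if_cong)
qed

text \<open>The lower block row (I 0) forces a Perron vector to have the form (\<rho> u, u); the
  upper row is then a quadratic eigenvalue equation for \<open>u\<close>.\<close>

lemma perron_eigenvector_iter_mat:
  fixes B C :: "real^'n^'n"
  assumes "nonneg_mat B" "nonneg_mat C" and \<rho>: "\<rho> = spec_rad (iter_mat B C)"
  obtains x where "0 \<le> x" "x \<noteq> 0" "\<rho>\<^sup>2 *\<^sub>R x = \<rho> *\<^sub>R (B *v x) + C *v x"
proof -
  obtain x where x: "0 \<le> x" "x \<noteq> 0" "iter_mat B C *v x = \<rho> *\<^sub>R x"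
    using perron_eigenvector[OF nonneg_iter_mat[OF assms(1,2)]] \<rho> by metis
  define u where "u = (\<chi> a. x $ Inr a)"
  have Inl: "x $ Inl a = \<rho> * u $ a" for a
    using iter_mat_mult_vec(2)[of B C x a] by (simp add: x(3) u_def)
  have Inl': "(\<chi> a. x $ Inl a) = \<rho> *\<^sub>R u"
    by (simp add: vec_eq_iff Inl)
  have "(\<rho>\<^sup>2 *\<^sub>R u) $ a = (\<rho> *\<^sub>R (B *v u) + C *v u) $ a" for a
  proof -
    have "\<rho> * x $ Inl a = (B *v (\<rho> *\<^sub>R u) + C *v u) $ a"
      using iter_mat_mult_vec(1)[of B C x a] unfolding Inl' by (simp add: x(3) u_def)
    then show ?thesis
      by (simp add: Inl matrix_vector_mult_scaleR power2_eq_square)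
  qed
  then have eig: "\<rho>\<^sup>2 *\<^sub>R u = \<rho> *\<^sub>R (B *v u) + C *v u"
    by (simp add: vec_eq_iff)
  have "0 \<le> u"
    using x(1) by (auto simp: less_eq_vec_def u_def)
  moreover have "u \<noteq> 0"
  proof
    assume "u = 0"
    then have "x $ k = 0" for k
      using Inl by (cases k) (auto simp: u_def vec_eq_iff)
    then show False
      using x(2) by (simp add: vec_eq_iff)
  qed
  ultimately show thesis
    using that eig by blast
qed

text \<open>The vector (\<rho> x, x) is a subeigenvector: the upper block is \<open>le\<close>, the
  lower one an equality.\<close>

lemma le_spec_rad_iter_mat:
  fixes B C :: "real^'n^'n"
  assumes "nonneg_mat B" "nonneg_mat C" "0 \<le> \<rho>" "0 \<le> x" "x \<noteq> 0"
    and le: "\<rho>\<^sup>2 *\<^sub>R x \<le> \<rho> *\<^sub>R (B *v x) + C *v x"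
  shows "\<rho> \<le> spec_rad (iter_mat B C)"
proof -
  define y :: "real^('n + 'n)" where
    "y = (\<chi> k. case k of Inl a \<Rightarrow> \<rho> * x $ a | Inr a \<Rightarrow> x $ a)"
  have y_Inl: "(\<chi> a. y $ Inl a) = \<rho> *\<^sub>R x" and Inr: "(\<chi> a. y $ Inr a) = x"
    by (simp_all add: y_def vec_eq_iff)
  have "(\<rho> *\<^sub>R y) $ k \<le> (iter_mat B C *v y) $ k" for k
  proof (cases k)
    case (Inl a)
    then show ?thesis
      using le unfolding Inl vector_scaleR_component iter_mat_mult_vec y_Inl Inr
      by (simp add: y_def less_eq_vec_def matrix_vector_mult_scaleR power2_eq_square mult.assoc)
  next
    case (Inr a)
    then show ?thesis
      by (simp add: iter_mat_mult_vec y_def)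
  qed
  then have "\<rho> *\<^sub>R y \<le> iter_mat B C *v y"
    by (simp add: less_eq_vec_def)
  moreover have "0 \<le> y"
    using assms(3,4) by (auto simp: less_eq_vec_def y_def split: sum.split)
  moreover have "y \<noteq> 0"
  proof
    assume "y = 0"
    then show False
      using assms(5) Inr by (simp add: zero_vec_def)
  qed
  ultimately show ?thesis
    using le_spec_rad_if_subeigenvector nonneg_iter_mat assms(1,2) by blast
qed

section \<open>Proper double splittings\<close>

context
  fixes A P R S :: "real^'n^'m"
  assumes pds: "proper_double_splitting A P R S"
begin

lemma pds_mult_mp_inv: "P ** mp_inv P = A ** mp_inv A"
  and pds_mp_inv_mult: "mp_inv P ** P = mp_inv A ** A"
  using pds mult_mp_inv_eq_if_range_eq[of A P] mp_inv_mult_eq_if_null_eq[of A P]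
  by (auto simp: proper_double_splitting_def)

lemma pds_mp_inv_diff:
  "mp_inv P ** R - mp_inv P ** S = mp_inv A ** A - mp_inv P ** A"
proof -
  have "mp_inv P ** A = mp_inv P ** P - mp_inv P ** R + mp_inv P ** S"
    using pds by (simp add: proper_double_splitting_def matrix_add_ldistrib matrix_mult_diff_distrib)
  then show ?thesis
    by (simp add: pds_mp_inv_mult)
qed

lemma weak_regular_subinvariant_zero:
  assumes A: "nonneg_mat (mp_inv A)" and P: "nonneg_mat (mp_inv P)"
    and T: "nonneg_mat (mp_inv P ** R - mp_inv P ** S)"
    and u: "0 \<le> u" "u \<le> (mp_inv P ** R - mp_inv P ** S) *v u"
  shows "u = 0"
proof -
  let ?T = "mp_inv P ** R - mp_inv P ** S"
  \<comment> \<open>The sign of \<open>(R - S) *v u\<close> is unknown; its modulus dominates it and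
    starts the induction with \<open>mp_inv A *v w\<close> nonnegative.\<close>
  define w where "w = (\<chi> i. \<bar>((R - S) *v u) $ i\<bar>)"
  have w: "0 \<le> w" "(R - S) *v u \<le> w"
    by (auto simp: w_def less_eq_vec_def)
  have "mp_inv P ** A ** mp_inv A = mp_inv P"
    by (metis matrix_mul_assoc mp_inv_self_mult pds_mult_mp_inv)
  then have "?T ** mp_inv A = mp_inv A - mp_inv P"
    by (simp add: pds_mp_inv_diff matrix_mult_diff_rdistrib)
  then have split: "mp_inv A *v w = mp_inv P *v w + ?T *v (mp_inv A *v w)"
    by (simp add: matrix_vector_mul_assoc matrix_vector_mult_diff_rdistrib)
  have Pw: "?T *v u \<le> mp_inv P *v w"
    using nonneg_mat_mult_vec_mono[OF P w(2)]
    by (simp add: matrix_vector_mul_assoc matrix_mult_diff_distrib)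
  have ge: "real N *\<^sub>R u \<le> mp_inv A *v w" for N
  proof (induction N)
    case 0
    show ?case
      using nonneg_mat_mult_vec[OF A w(1)] by simp
  next
    case (Suc N)
    \<comment> \<open>One of the \<open>N + 1\<close> copies of \<open>?T *v u\<close> is absorbed
      by \<open>mp_inv P *v w\<close>, the other \<open>N\<close> by the induction
      hypothesis.\<close>
    have "real (Suc N) *\<^sub>R u \<le> real (Suc N) *\<^sub>R (?T *v u)"
      using u(2) by (intro scaleR_left_mono) auto
    also have "\<dots> = ?T *v u + ?T *v (real N *\<^sub>R u)"
      by (simp add: matrix_vector_mult_scaleR algebra_simps)
    also have "\<dots> \<le> mp_inv P *v w + ?T *v (mp_inv A *v w)"
      by (intro add_mono Pw nonneg_mat_mult_vec_mono[OF T] Suc)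
    finally show ?case
      by (simp add: split[symmetric])
  qed
  have "u $ i = 0" for i
  proof (rule ccontr)
    assume "u $ i \<noteq> 0"
    then have "u $ i > 0"
      using u(1) by (simp add: less_eq_vec_def order_less_le)
    then obtain N where "(mp_inv A *v w) $ i < real N * u $ i"
      using reals_Archimedean3 by blast
    then show False
      using ge[of N] by (simp add: less_eq_vec_def not_le[symmetric])
  qed
  then show ?thesis
    by (simp add: vec_eq_iff)
qed

lemma weak_regular_spec_rad_less_1:
  assumes A: "nonneg_mat (mp_inv A)" and P: "nonneg_mat (mp_inv P)"
    and B: "nonneg_mat (mp_inv P ** R)" and C: "nonneg_mat (- (mp_inv P ** S))"
  shows "spec_rad (iter_mat (mp_inv P ** R) (- (mp_inv P ** S))) < 1"
proof (rule ccontr)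
  let ?\<rho> = "spec_rad (iter_mat (mp_inv P ** R) (- (mp_inv P ** S)))"
  let ?B = "mp_inv P ** R" and ?C = "- (mp_inv P ** S)"
  assume "\<not> ?\<rho> < 1"
  then have \<rho>: "?\<rho> \<ge> 1"
    by simp
  obtain x where x: "0 \<le> x" "x \<noteq> 0" "?\<rho>\<^sup>2 *\<^sub>R x = ?\<rho> *\<^sub>R (?B *v x) + ?C *v x"
    using perron_eigenvector_iter_mat[OF B C refl] \<rho> by force
  \<comment> \<open>As \<rho> \<ge> 1, both coefficients of the quadratic equation are at most
    \<rho>^2; cancelling \<rho>^2 leaves \<open>x\<close> below its image under
    \<open>?B + ?C\<close>.\<close>
  have "?\<rho> *\<^sub>R (?B *v x) \<le> ?\<rho>\<^sup>2 *\<^sub>R (?B *v x)"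
    using nonneg_mat_mult_vec[OF B x(1)] \<rho> by (intro scaleR_right_mono) (auto simp: power2_eq_square)
  moreover have "1 *\<^sub>R (?C *v x) \<le> ?\<rho>\<^sup>2 *\<^sub>R (?C *v x)"
    using nonneg_mat_mult_vec[OF C x(1)] \<rho> by (intro scaleR_right_mono) (auto simp: one_le_power)
  ultimately have "?\<rho>\<^sup>2 *\<^sub>R x \<le> ?\<rho>\<^sup>2 *\<^sub>R (?B *v x + ?C *v x)"
    unfolding x(3) scaleR_add_right by (intro add_mono) auto
  then have "x \<le> ?B *v x + ?C *v x"
    using \<rho> by (auto simp: less_eq_vec_def)
  moreover have "?B *v x + ?C *v x = (?B - mp_inv P ** S) *v x"
    by (simp add: matrix_vector_mult_add_rdistrib[symmetric])
  moreover have "nonneg_mat (?B - mp_inv P ** S)"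
    using B C by (fastforce simp: nonneg_mat_def intro: order_trans)
  ultimately have "x = 0"
    using weak_regular_subinvariant_zero[OF A P _ x(1)] by simp
  then show False
    using x(2) by simp
qed

end

section \<open>Comparison of the two spectral radii\<close>

theorem theorem3p1:
  fixes A P1 R1 S1 P2 R2 S2 :: "real^'n^'m"
  assumes "nonneg_mat (mp_inv A)"
    and "regular_pds A P1 R1 S1"
    and "nonneg_mat (P1 ** mp_inv P1)"
    and "weak_regular_pds A P2 R2 S2"
    and "nonneg_mat (mp_inv P1 - mp_inv P2)"
    and "nonneg_mat (mp_inv P1 ** R1 - mp_inv P2 ** R2) \<or>
         nonneg_mat (mp_inv P1 ** S1 - mp_inv P2 ** S2)"
  shows "spec_rad (iter_mat (mp_inv P1 ** R1) (- (mp_inv P1 ** S1)))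
           \<le> spec_rad (iter_mat (mp_inv P2 ** R2) (- (mp_inv P2 ** S2)))
       \<and> spec_rad (iter_mat (mp_inv P2 ** R2) (- (mp_inv P2 ** S2))) < 1"
proof
  let ?B1 = "mp_inv P1 ** R1" and ?C1 = "- (mp_inv P1 ** S1)"
  let ?B2 = "mp_inv P2 ** R2" and ?C2 = "- (mp_inv P2 ** S2)"
  let ?\<rho> = "spec_rad (iter_mat ?B1 ?C1)"
  have pds1: "proper_double_splitting A P1 R1 S1" and P1: "nonneg_mat (mp_inv P1)"
    and R1: "nonneg_mat R1" and S1: "nonneg_mat (- S1)"
    using assms(2) by (auto simp: regular_pds_def)
  have pds2: "proper_double_splitting A P2 R2 S2" and P2: "nonneg_mat (mp_inv P2)"
    and B2: "nonneg_mat ?B2" and C2: "nonneg_mat ?C2"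
    using assms(4) by (auto simp: weak_regular_pds_def)
  have mult_neg: "M ** (- S1) = - (M ** S1)" for M :: "real^'m^'k"
    by (simp add: vec_eq_iff matrix_matrix_mult_def sum_negf)
  have B1: "nonneg_mat ?B1"
    by (rule nonneg_mat_mult[OF P1 R1])
  have C1: "nonneg_mat ?C1"
    using nonneg_mat_mult[OF P1 S1] by (simp add: mult_neg)
  show "spec_rad (iter_mat ?B2 ?C2) < 1"
    by (rule weak_regular_spec_rad_less_1[OF pds2 assms(1) P2 B2 C2])
  have less1: "?\<rho> < 1"
    by (rule weak_regular_spec_rad_less_1[OF pds1 assms(1) P1 B1 C1])
  show "?\<rho> \<le> spec_rad (iter_mat ?B2 ?C2)"
  \<comment> \<open>A positive \<rho> allows cancelling \<rho>^2 when the sign of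
    \<open>A *v x\<close> is determined.\<close>
  proof (cases "?\<rho> > 0")
    case False
    then show ?thesis
      using nonneg_mat_spec_rad_nonneg[OF nonneg_iter_mat[OF B2 C2]] by simp
  next
    case True
    obtain x where x: "0 \<le> x" "x \<noteq> 0" "?\<rho>\<^sup>2 *\<^sub>R x = ?\<rho> *\<^sub>R (?B1 *v x) + ?C1 *v x"
      using perron_eigenvector_iter_mat[OF B1 C1 refl] True by metis
    have sq: "?\<rho>\<^sup>2 \<le> ?\<rho>" "?\<rho>\<^sup>2 \<le> 1"
      using True less1 by (auto simp: power2_eq_square mult_le_one)
    text \<open>\<open>R1\<close> and \<open>S1\<close> need not have their columns in the range of \<open>P1\<close>, so \<open>A x\<close> is expanded
      only after projecting with \<open>P1 P1\<^sup>\<dagger>\<close>, which is nonnegative by assumption.\<close>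
    let ?r = "P1 *v (?B1 *v x)" and ?s = "P1 *v (?C1 *v x)"
    have r: "0 \<le> ?r"
      using nonneg_mat_mult_vec[OF nonneg_mat_mult[OF assms(3) R1] x(1)]
      by (simp add: matrix_vector_mul_assoc matrix_mul_assoc)
    have s: "0 \<le> ?s"
      using nonneg_mat_mult_vec[OF nonneg_mat_mult[OF assms(3) S1] x(1)]
      by (simp add: matrix_vector_mul_assoc matrix_mul_assoc flip: mult_neg)
    have eig: "?\<rho>\<^sup>2 *\<^sub>R (P1 *v x) = ?\<rho> *\<^sub>R ?r + ?s"
      using arg_cong[OF x(3), of "\<lambda>y. P1 *v y"]
      by (simp add: matrix_vector_mult_scaleR matrix_vector_right_distrib)
    have range_A: "P1 ** mp_inv P1 ** A = A"
      using range_projection_absorbs[of A P1] pds1 by (auto simp: proper_double_splitting_def)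
    have "P1 ** (?B1 - mp_inv P1 ** S1) = P1 ** (mp_inv P1 ** P1 - mp_inv P1 ** A)"
      using pds_mp_inv_diff[OF pds1] pds_mp_inv_mult[OF pds1] by simp
    also have "\<dots> = P1 - A"
      using range_A by (simp add: matrix_mult_diff_distrib matrix_mul_assoc)
    finally have "(P1 ** (?B1 + ?C1)) *v x = (P1 - A) *v x"
      by simp
    then have "?r + ?s = P1 *v x - A *v x"
      by (simp only: matrix_add_ldistrib matrix_vector_mult_add_rdistrib
          matrix_vector_mult_diff_rdistrib matrix_vector_mul_assoc)
    then have Ax: "A *v x = P1 *v x - ?r - ?s"
      by (simp only: diff_diff_eq diff_diff_eq2 add_diff_cancel_left')
    \<comment> \<open>Substituting \<open>eig\<close> for the term in \<open>P1 *v x\<close> leaves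
      coefficients that are nonnegative because 0 < \<rho> < 1.\<close>
    have "?\<rho>\<^sup>2 *\<^sub>R (A *v x) = (?\<rho> - ?\<rho>\<^sup>2) *\<^sub>R ?r + (1 - ?\<rho>\<^sup>2) *\<^sub>R ?s"
      unfolding Ax scaleR_diff_right eig by (simp add: algebra_simps)
    also have "\<dots> \<ge> 0"
      using sq r s by (intro add_nonneg_nonneg scaleR_nonneg_nonneg) auto
    finally have "0 \<le> A *v x"
      using True by (simp add: less_eq_vec_def zero_le_mult_iff)
    then have "0 \<le> (mp_inv P1 - mp_inv P2) *v (A *v x)"
      by (rule nonneg_mat_mult_vec[OF assms(5)])
    \<comment> \<open>The common term \<open>mp_inv A ** A\<close> cancels in the difference of the
      two splitting identities.\<close>
    also have "(mp_inv P1 - mp_inv P2) *v (A *v x) =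
        ((?B2 - mp_inv P2 ** S2) - (?B1 - mp_inv P1 ** S1)) *v x"
      unfolding pds_mp_inv_diff[OF pds1] pds_mp_inv_diff[OF pds2]
      by (simp add: matrix_vector_mul_assoc matrix_mult_diff_rdistrib)
    also have "(?B2 - mp_inv P2 ** S2) - (?B1 - mp_inv P1 ** S1) = (?B2 - ?B1) + (?C2 - ?C1)"
      by simp
    finally have T: "0 \<le> (?B2 - ?B1) *v x + (?C2 - ?C1) *v x"
      by (simp only: matrix_vector_mult_add_rdistrib)
    define b where "b = (?B2 - ?B1) *v x"
    define c where "c = (?C2 - ?C1) *v x"
    have bc: "0 \<le> b + c"
      using T by (simp only: b_def c_def)
    have "0 \<le> ?\<rho> *\<^sub>R b + c"
      using assms(6)
    proof
      assume "nonneg_mat (?B1 - ?B2)"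
      \<comment> \<open>Here \<open>b\<close> is nonpositive, so shrinking it by \<rho> < 1 only
        increases the sum \<open>b + c\<close>.\<close>
      from nonneg_mat_mult_vec[OF this x(1)] have "b \<le> 0"
        by (simp add: b_def matrix_vector_mult_diff_rdistrib)
      then have "b \<le> ?\<rho> *\<^sub>R b"
        using scaleR_right_mono_neg[of ?\<rho> 1 b] less1 by simp
      then show ?thesis
        using bc by (meson add_right_mono order_trans)
    next
      assume S: "nonneg_mat (mp_inv P1 ** S1 - mp_inv P2 ** S2)"
      have "mp_inv P1 ** S1 - mp_inv P2 ** S2 = ?C2 - ?C1"
        by simp
      with nonneg_mat_mult_vec[OF S x(1)] have "0 \<le> c"
        by (simp only: c_def)
      \<comment> \<open>With \<open>c\<close> nonnegative, \<rho> b + c is a convex combination of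
        \<open>c\<close> and \<open>b + c\<close>.\<close>
      then have "0 \<le> (1 - ?\<rho>) *\<^sub>R c + ?\<rho> *\<^sub>R (b + c)"
        using less1 True bc
        by (intro add_nonneg_nonneg[OF scaleR_nonneg_nonneg scaleR_nonneg_nonneg]) auto
      then show ?thesis
        by (simp add: algebra_simps)
    qed
    then have "0 \<le> ?\<rho> *\<^sub>R (?B2 *v x) + ?C2 *v x - (?\<rho> *\<^sub>R (?B1 *v x) + ?C1 *v x)"
      by (simp only: b_def c_def matrix_vector_mult_diff_rdistrib scaleR_diff_right
          add_diff_add)
    then have "?\<rho>\<^sup>2 *\<^sub>R x \<le> ?\<rho> *\<^sub>R (?B2 *v x) + ?C2 *v x"
      by (simp only: x(3) le_diff_eq add_0_left)
    then show ?thesis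
      using le_spec_rad_iter_mat[OF B2 C2 _ x(1,2)] True by simp
  qed
qed

end
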